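(* Suppose that there is a constant $\alpha>0$ such that $\mathbb{P}_\infty(Y>m)\le e^{-\alpha m}$ for all $m\ge 1$, where $Y=\inf\{k\ge 1:(\widehat W[k])^+=0\}$ and $\widehat W[k]$ is the D-CuSum statistic. Then the D-CuSum stopping time $\widehat\tau(b)$ with threshold $b>0$ satisfies $$\mathbb{E}_\infty[\widehat\tau(b)]\ \ge\ \frac{e^b}{1+(b/\alpha)^{L+1}}.$$
   Context: Model. Let $L\ge 1$ be a known integer and $f_0,f_1,\dots,f_L$ known probability densities with respect to a common measure. For each $1\le i\le L$ the Kullback-Leibler divergence $I_i=\int f_i\log\frac{f_i}{f_0}$ is assumed positive and finite. Independent random variables $X_1,X_2,\dots$ are observed sequentially. For a change-point $v_1\ge1$ and a vector of transient durations $\boldsymbol d=(d_1,\dots,d_{L-1})$ of nonnegative integers, set $v_0=1$, $v_{i+1}=v_i+d_i$ for $1\le i\le L-1$, and $v_{L+1}=\infty$. Under $\mathbb{P}^{\boldsymbol d}_{v_1}$ the $X_k$ are independent with $X_k\sim f_i$ if $v_i\le k<v_{i+1}$, $0\le i\le L$ (so $X_k\sim f_0$ for $k<v_1$). Under $\mathbb{P}_\infty$ (expectation $\mathbb{E}_\infty$) there is no change: all $X_k$ are i.i.d. with density $f_0$. D-CuSum algorithm. For $1\le v_1\le k$ and $\boldsymbol d\in\mathbb N^{L-1}$ (with $0\in\mathbb N$), let $\Gamma(k,v_1,\boldsymbol d)$ be the likelihood ratio of $X_1,\dots,X_k$ under $\mathbb{P}^{\boldsymbol d}_{v_1}$ versus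 $\mathbb{P}_\infty$, i.e. $\Gamma(k,v_1,\boldsymbol d)=\prod_{i=1}^{L}\prod_{j=v_i}^{\min\{v_{i+1}-1,k\}}\frac{f_i(X_j)}{f_0(X_j)}$ (empty products equal $1$). The D-CuSum statistic is $\widehat W[k]=\max_{1\le v_1\le k}\max_{\boldsymbol d\in\mathbb N^{L-1}}\log\Gamma(k,v_1,\boldsymbol d)$ (a maximum over finitely many distinct values), and $\widehat\tau(b)=\inf\{k\ge1:\widehat W[k]>b\}$. Here $x^+=\max\{x,0\}$. *)

theory Defs
  imports "HOL-Probability.Probability"
begin

definition is_prob_density :: "'a measure \<Rightarrow> ('a \<Rightarrow> real) \<Rightarrow> bool" where
  "is_prob_density M p \<longleftrightarrow>
     p \<in> borel_measurable M \<and> (\<forall>x\<in>space M. 0 \<le> p x) \<and> (\<integral>\<^sup>+ x. ennreal (p x) \<partial>M) = 1"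

text \<open>
  The divergence of \<open>p\<close> from \<open>q\<close> with values in \<open>(-\<infinity>, \<infinity>]\<close>. The negative part of
  \<open>p * ln (p / q)\<close> is always integrable for probability densities, so without absolute continuity
  or without integrability the value is \<open>\<infinity>\<close>. In the finite case the points with \<open>p x = 0\<close>
  contribute \<open>0\<close>, as usual. The lemma below relates this to the library's \<open>KL_divergence\<close>, which
  is real-valued and hence does not by itself express finiteness.
\<close>

definition kl_div :: "'a measure \<Rightarrow> ('a \<Rightarrow> real) \<Rightarrow> ('a \<Rightarrow> real) \<Rightarrow> ereal" where
  "kl_div M p q =
     (if (AE x in M. q x = 0 \<longrightarrow> p x = 0) \<and> integrable M (\<lambda>x. p x * ln (p x / q x))
      then ereal (\<integral>x. p x * ln (p x / q x) \<partial>M) else \<infinity>)"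

lemma kl_div_eq_KL_divergence:
  assumes "sigma_finite_measure M" "is_prob_density M p" "is_prob_density M q"
    and "kl_div M p q < \<infinity>"
  shows "kl_div M p q = ereal (KL_divergence (exp 1) (density M q) (density M p))"
proof -
  interpret sigma_finite_measure M by fact
  have "AE x in M. q x = 0 \<longrightarrow> p x = 0"
    using assms(4) by (auto simp: kl_div_def split: if_splits)
  then have "KL_divergence (exp 1) (density M q) (density M p)
      = (\<integral>x. p x * log (exp 1) (p x / q x) \<partial>M)"
    using assms(2,3) by (intro KL_density_density) (auto simp: is_prob_density_def)
  then show ?thesis
    using assms(4) by (auto simp: kl_div_def log_def split: if_splits)
qed

text \<open>
  The change-points \<open>v\<^sub>0, \<dots>, v\<^bsub>L+1\<^esub>\<close>; only the components \<open>d 1, \<dots>, d (L - 1)\<close>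
  of the vector of durations are used.
\<close>

definition change_point :: "nat \<Rightarrow> nat \<Rightarrow> (nat \<Rightarrow> nat) \<Rightarrow> nat \<Rightarrow> enat" where
  "change_point L v1 d i =
     (if i = 0 then 1 else if i \<le> L then enat (v1 + (\<Sum>j\<in>{1..<i}. d j)) else \<infinity>)"

text \<open>
  The likelihood ratio \<open>\<Gamma>(k, v\<^sub>1, d)\<close> evaluated at the observations \<open>x 1, \<dots>, x k\<close>. The value of
  \<open>f i / f 0\<close> at zeros of \<open>f 0\<close> is immaterial, as they have probability zero under no change.
\<close>

definition lik_ratio ::
    "(nat \<Rightarrow> 'a \<Rightarrow> real) \<Rightarrow> nat \<Rightarrow> (nat \<Rightarrow> 'a) \<Rightarrow> nat \<Rightarrow> nat \<Rightarrow> (nat \<Rightarrow> nat) \<Rightarrow> real" where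
  "lik_ratio f L x k v1 d =
     (\<Prod>i=1..L. \<Prod>j | change_point L v1 d i \<le> enat j \<and> enat j < change_point L v1 d (Suc i) \<and> j \<le> k.
        f i (x j) / f 0 (x j))"

text \<open>The logarithm of a nonnegative number, with \<open>log 0 = -\<infinity>\<close> (whereas \<open>ln 0 = 0\<close> on \<open>real\<close>).\<close>

definition ext_ln :: "real \<Rightarrow> ereal" where
  "ext_ln r = (if r = 0 then -\<infinity> else ereal (ln r))"

text \<open>
  The D-CuSum statistic. For \<open>k \<ge> 1\<close> the suprema are attained, because durations beyond \<open>k\<close> do
  not change the likelihood ratio.
\<close>

definition dcusum :: "(nat \<Rightarrow> 'a \<Rightarrow> real) \<Rightarrow> nat \<Rightarrow> (nat \<Rightarrow> 'a) \<Rightarrow> nat \<Rightarrow> ereal" where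
  "dcusum f L x k =
     (SUP v1\<in>{1..k}. SUP d\<in>{1..<L} \<rightarrow>\<^sub>E (UNIV :: nat set). ext_ln (lik_ratio f L x k v1 d))"

definition dcusum_time :: "(nat \<Rightarrow> 'a \<Rightarrow> real) \<Rightarrow> nat \<Rightarrow> real \<Rightarrow> (nat \<Rightarrow> 'a) \<Rightarrow> enat" where
  "dcusum_time f L b x = Inf {enat k | k. 1 \<le> k \<and> dcusum f L x k > ereal b}"

definition dcusum_zero_time :: "(nat \<Rightarrow> 'a \<Rightarrow> real) \<Rightarrow> nat \<Rightarrow> (nat \<Rightarrow> 'a) \<Rightarrow> enat" where
  "dcusum_zero_time f L x = Inf {enat k | k. 1 \<le> k \<and> max (dcusum f L x k) 0 = 0}"

end

theory Submission
  imports Defs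
begin

text \<open>
  A choice of change-points up to time \<open>k\<close> is a nondecreasing path of states in \<open>{0..L}\<close>, so the
  statistic exceeds a level iff the likelihood ratio along one of the at most \<open>(k + L choose L) - 1\<close>
  paths with nonzero final state does. Call a time with nonpositive statistic, or time 0, a renewal
  time. If the threshold is crossed by time \<open>n\<close>, let \<open>k < n\<close> be the last renewal time before the
  first crossing: then \<open>\<tau> > k\<close>, and the observations after \<open>k\<close>, on their own, cross the threshold
  within their first cycle. The past of \<open>k\<close> is independent of its future, so with \<open>p\<close> the probability
  of a crossing in the first cycle, \<open>P(\<tau> \<le> n) \<le> p * (\<Sum>k<n. P(\<tau> > k)) \<le> p * E \<tau>\<close>, hence
  \<open>1 \<le> p * E \<tau>\<close>. To bound \<open>p\<close>, either the cycle lasts longer than \<open>m = b / \<alpha>\<close>, which has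
  probability at most \<open>exp (- b)\<close>, or one of the paths of length at most \<open>m\<close> has likelihood ratio
  above \<open>exp b\<close>; each of these has probability at most \<open>exp (- b)\<close> by Markov's inequality, and for
  \<open>m \<ge> 2\<close> there are at most \<open>m ^ (L + 1)\<close> of them. For \<open>m < 2\<close> this count fails, but a crossing
  forces a cycle longer than 1, and for integer-valued cycle lengths this means longer than
  \<open>max 1 m\<close>.
\<close>

section \<open>State paths\<close>

text \<open>State 0 gets the value 1 and not \<open>f 0 y / f 0 y\<close>, which would be 0 at zeros
  of \<open>f 0\<close>, so times before the change never affect a product.\<close>

definition score :: "(nat \<Rightarrow> 'a \<Rightarrow> real) \<Rightarrow> nat \<Rightarrow> 'a \<Rightarrow> real" where
  "score f i y = (if i = 0 then 1 else f i y / f 0 y)"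

definition path_lik :: "(nat \<Rightarrow> 'a \<Rightarrow> real) \<Rightarrow> (nat \<Rightarrow> nat) \<Rightarrow> (nat \<Rightarrow> 'a) \<Rightarrow> nat \<Rightarrow> real" where
  "path_lik f s x k = (\<Prod>j\<in>{1..k}. score f (s j) (x j))"

text \<open>A path records which density is in force at each time, so change-points and durations
  that agree up to time \<open>k\<close> give the same path. Extensionality makes the set
  finite.\<close>

definition state_paths :: "nat \<Rightarrow> nat \<Rightarrow> (nat \<Rightarrow> nat) set" where
  "state_paths L k = {s \<in> {1..k} \<rightarrow>\<^sub>E {0..L}. mono_on {1..k} s}"

definition active_paths :: "nat \<Rightarrow> nat \<Rightarrow> (nat \<Rightarrow> nat) set" where
  "active_paths L k = {s \<in> state_paths L k. 1 \<le> s k}"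

text \<open>For \<open>k \<ge> 1\<close> and nonnegative densities this says that the statistic is
  above \<open>c\<close>. As a finite disjunction free of logarithms it is suited to measurability
  and union bounds.\<close>

definition exceeds :: "(nat \<Rightarrow> 'a \<Rightarrow> real) \<Rightarrow> nat \<Rightarrow> real \<Rightarrow> (nat \<Rightarrow> 'a) \<Rightarrow> nat \<Rightarrow> bool" where
  "exceeds f L c x k \<longleftrightarrow> (\<exists>s\<in>active_paths L k. exp c < path_lik f s x k)"

lemma finite_state_paths: "finite (state_paths L k)"
  unfolding state_paths_def by (rule finite_subset[OF _ finite_PiE[of "{1..k}" "\<lambda>_. {0..L}"]]) auto

lemma finite_active_paths: "finite (active_paths L k)"
  unfolding active_paths_def using finite_state_paths by simp

lemma active_paths_le: "s \<in> active_paths L k \<Longrightarrow> j \<in> {1..k} \<Longrightarrow> s j \<le> L"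
  unfolding active_paths_def state_paths_def by (auto simp: PiE_iff)

lemma active_paths_mono:
  "s \<in> active_paths L k \<Longrightarrow> 1 \<le> i \<Longrightarrow> i \<le> j \<Longrightarrow> j \<le> k \<Longrightarrow> s i \<le> s j"
  unfolding active_paths_def state_paths_def by (auto simp: mono_on_def)

lemma path_lik_cong:
  "(\<And>j. j \<in> {1..k} \<Longrightarrow> s j = t j) \<Longrightarrow> (\<And>j. j \<in> {1..k} \<Longrightarrow> x j = y j) \<Longrightarrow>
    path_lik f s x k = path_lik f t y k"
  unfolding path_lik_def by (intro prod.cong) auto

lemma exceeds_cong:
  assumes "\<And>j. j \<in> {1..k} \<Longrightarrow> x j = y j"
  shows "exceeds f L c x k \<longleftrightarrow> exceeds f L c y k"
proof -
  have "path_lik f s x k = path_lik f s y k" for s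
    using assms by (intro path_lik_cong) auto
  then show ?thesis unfolding exceeds_def by simp
qed

lemma path_lik_nonneg:
  assumes "\<And>i j. i \<le> L \<Longrightarrow> j \<in> {1..k} \<Longrightarrow> 0 \<le> f i (x j)" "\<And>j. j \<in> {1..k} \<Longrightarrow> s j \<le> L"
  shows "0 \<le> path_lik f s x k"
  unfolding path_lik_def score_def using assms by (intro prod_nonneg) auto

text \<open>The last hypothesis makes \<open>s j\<close> the index of the last change-point not
  after \<open>j\<close>. Exchanging the products regroups the factors by time; a time with
  \<open>s j = 0\<close> has an empty inner product, which is the value of \<open>score\<close> at
  state 0.\<close>

lemma lik_ratio_eq_path_lik:
  assumes v1: "1 \<le> v1" and sL: "\<And>j. j \<in> {1..k} \<Longrightarrow> s j \<le> L"
    and s: "\<And>i j. 1 \<le> i \<Longrightarrow> i \<le> L \<Longrightarrow> j \<in> {1..k} \<Longrightarrow>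
      v1 + (\<Sum>l\<in>{1..<i}. d l) \<le> j \<longleftrightarrow> i \<le> s j"
  shows "lik_ratio f L x k v1 d = path_lik f s x k"
proof -
  have J: "{j. change_point L v1 d i \<le> enat j \<and> enat j < change_point L v1 d (Suc i) \<and> j \<le> k}
      = {j \<in> {1..k}. s j = i}" if i: "i \<in> {1..L}" for i
  proof -
    have 1: "change_point L v1 d i \<le> enat j \<longleftrightarrow> i \<le> s j" if "j \<in> {1..k}" for j
      using s[of i j] i that by (auto simp: change_point_def)
    have 2: "enat j < change_point L v1 d (Suc i) \<longleftrightarrow> s j < Suc i" if "j \<in> {1..k}" for j
    proof (cases "Suc i \<le> L")
      case True
      then show ?thesis
        using s[of "Suc i" j] i that
        by (simp add: change_point_def) linarith
    next
      \<comment> \<open>Here \<open>i = L\<close>: the next change-point is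
        \<open>\<infinity>\<close>, and \<open>s j \<le> L\<close> makes both sides true.\<close>
      case False
      then show ?thesis using i sL[OF that] by (auto simp: change_point_def)
    qed
    have 3: "1 \<le> j" if "change_point L v1 d i \<le> enat j" for j
      using that i v1 by (auto simp: change_point_def)
    show ?thesis
    proof (intro Collect_cong iffI)
      fix j assume "change_point L v1 d i \<le> enat j \<and> enat j < change_point L v1 d (Suc i) \<and> j \<le> k"
      then show "j \<in> {1..k} \<and> s j = i" using 1[of j] 2[of j] 3[of j] by auto
    next
      fix j assume "j \<in> {1..k} \<and> s j = i"
      then show "change_point L v1 d i \<le> enat j \<and> enat j < change_point L v1 d (Suc i) \<and> j \<le> k"
        using 1[of j] 2[of j] by auto
    qed
  qed
  have "lik_ratio f L x k v1 d =
      (\<Prod>i\<in>{1..L}. \<Prod>j | j \<in> {1..k} \<and> s j = i. f i (x j) / f 0 (x j))"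
    unfolding lik_ratio_def by (intro prod.cong) (auto simp only: J)
  also have "\<dots> = (\<Prod>j\<in>{1..k}. \<Prod>i | i \<in> {1..L} \<and> s j = i. f i (x j) / f 0 (x j))"
    by (rule prod.swap_restrict) auto
  also have "\<dots> = path_lik f s x k"
    unfolding path_lik_def
  proof (rule prod.cong[OF refl])
    fix j assume j: "j \<in> {1..k}"
    have "{i. i \<in> {1..L} \<and> s j = i} = (if s j = 0 then {} else {s j})"
      using sL[OF j] by auto
    then show "(\<Prod>i | i \<in> {1..L} \<and> s j = i. f i (x j) / f 0 (x j)) = score f (s j) (x j)"
      by (simp add: score_def)
  qed
  finally show ?thesis .
qed

text \<open>Take for \<open>s j\<close> the largest index in \<open>{0..L}\<close> of a change-point
  not after \<open>j\<close>. It is monotone in \<open>j\<close>, and \<open>v1 \<le> k\<close>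
  makes the final state nonzero.\<close>

lemma path_of_change_points:
  assumes v1: "1 \<le> v1" "v1 \<le> k" and L: "1 \<le> L"
  obtains s where "s \<in> active_paths L k" "\<And>f x. lik_ratio f L x k v1 d = path_lik f s x k"
proof -
  \<comment> \<open>\<open>c 0 = 1\<close> keeps index 0 admissible at every time
    \<open>j \<ge> 1\<close>, so the maximum below is over a nonempty set.\<close>
  define c where "c i = (if i = 0 then 1 else v1 + (\<Sum>l\<in>{1..<i}. d l))" for i
  have c_mono: "c i \<le> c j" if "i \<le> j" for i j
    using that v1 by (auto simp: c_def intro!: sum_mono2)
  define s where "s = (\<lambda>j\<in>{1..k}. Max {i \<in> {0..L}. c i \<le> j})"
  have s_iff: "c i \<le> j \<longleftrightarrow> i \<le> s j" if "i \<le> L" "j \<in> {1..k}" for i j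
  proof -
    let ?A = "{i \<in> {0..L}. c i \<le> j}"
    have "0 \<in> ?A" using that by (auto simp: c_def)
    then have "Max ?A \<in> ?A" by (intro Max_in) auto
    then have "c (s j) \<le> j" using that by (auto simp: s_def)
    moreover have "i \<le> Max ?A" if "c i \<le> j" using that \<open>i \<le> L\<close> by (intro Max_ge) auto
    ultimately show ?thesis using c_mono[of i "s j"] that by (auto simp: s_def)
  qed
  have sL: "s j \<le> L" if "j \<in> {1..k}" for j
  proof -
    let ?A = "{i \<in> {0..L}. c i \<le> j}"
    have "0 \<in> ?A" using that by (auto simp: c_def)
    then have "Max ?A \<in> ?A" by (intro Max_in) auto
    then show ?thesis using that by (auto simp: s_def)
  qed
  have "s i \<le> s j" if "i \<in> {1..k}" "j \<in> {1..k}" "i \<le> j" for i j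
    using s_iff[of "s i" i] s_iff[of "s i" j] sL that by auto
  moreover have "1 \<le> s k"
    using s_iff[of 1 k] L v1 by (auto simp: c_def)
  ultimately have "s \<in> active_paths L k"
    using sL by (auto simp: active_paths_def state_paths_def mono_on_def s_def)
  moreover have "lik_ratio f L x k v1 d = path_lik f s x k" for f :: "nat \<Rightarrow> 'b \<Rightarrow> real" and x
  proof (rule lik_ratio_eq_path_lik)
    show "v1 + (\<Sum>l\<in>{1..<i}. d l) \<le> j \<longleftrightarrow> i \<le> s j" if "1 \<le> i" "i \<le> L" "j \<in> {1..k}" for i j
      using s_iff[of i j] that by (auto simp: c_def)
  qed (use sL v1 in auto)
  ultimately show ?thesis using that by blast
qed

text \<open>The converse construction: the \<open>i\<close>-th change-point is the first time at
  which the path is in state \<open>i\<close> or above, and the durations are differences of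
  successive such times.\<close>

lemma change_points_of_path:
  assumes s: "s \<in> active_paths L k" and k: "1 \<le> k"
  obtains v1 d where "1 \<le> v1" "v1 \<le> k" "d \<in> {1..<L} \<rightarrow>\<^sub>E (UNIV :: nat set)"
    "\<And>f x. lik_ratio f L x k v1 d = path_lik f s x k"
proof -
  \<comment> \<open>The implication makes \<open>Suc k\<close> a candidate, so states above
    \<open>s k\<close> get the change-point \<open>Suc k\<close>, beyond the horizon.\<close>
  define c where "c i = (LEAST j. 1 \<le> j \<and> (j \<le> k \<longrightarrow> i \<le> s j))" for i
  have c_prop: "1 \<le> c i \<and> (c i \<le> k \<longrightarrow> i \<le> s (c i))" for i
    unfolding c_def by (rule LeastI[of _ "Suc k"]) auto
  have c_le: "c i \<le> j" if "1 \<le> j" "j \<le> k \<longrightarrow> i \<le> s j" for i j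
    unfolding c_def using that by (intro Least_le) auto
  have c_iff: "c i \<le> j \<longleftrightarrow> i \<le> s j" if "j \<in> {1..k}" for i j
    using c_prop[of i] c_le[of j i] active_paths_mono[OF s, of "c i" j] that by auto
  have c_mono: "c i \<le> c j" if "i \<le> j" for i j
    using c_prop[of j] that by (intro c_le) auto
  define d where "d = (\<lambda>i\<in>{1..<L}. c (Suc i) - c i)"
  have c_sum: "c 1 + (\<Sum>l\<in>{1..<i}. d l) = c i" if "1 \<le> i" "i \<le> L" for i
    using that
  proof (induction i rule: dec_induct)
    case (step n)
    then show ?case using c_mono[of n "Suc n"] by (simp add: d_def)
  qed simp
  have "c 1 \<le> k" using c_iff[of k 1] s k by (auto simp: active_paths_def)
  moreover have "d \<in> {1..<L} \<rightarrow>\<^sub>E (UNIV :: nat set)" by (simp add: d_def)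
  moreover have "lik_ratio f L x k (c 1) d = path_lik f s x k"
    for f :: "nat \<Rightarrow> 'b \<Rightarrow> real" and x
    proof (rule lik_ratio_eq_path_lik)
    show "c 1 + (\<Sum>l\<in>{1..<i}. d l) \<le> j \<longleftrightarrow> i \<le> s j" if "1 \<le> i" "i \<le> L" "j \<in> {1..k}" for i j
      using c_sum[OF that(1,2)] c_iff[OF that(3)] by simp
  qed (use c_prop active_paths_le[OF s] in auto)
  ultimately show ?thesis using that c_prop by blast
qed

lemma ext_ln_greater_iff: "0 \<le> r \<Longrightarrow> ereal c < ext_ln r \<longleftrightarrow> exp c < r"
  unfolding ext_ln_def using ln_less_cancel_iff[of "exp c" r] by auto

text \<open>Strictness turns the suprema into an existential statement over change-points, which the
  two translations above match with paths.\<close>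

lemma dcusum_greater_iff:
  assumes L: "1 \<le> L" and k: "1 \<le> k"
    and f: "\<And>i j. i \<le> L \<Longrightarrow> j \<in> {1..k} \<Longrightarrow> 0 \<le> f i (x j)"
  shows "ereal c < dcusum f L x k \<longleftrightarrow> exceeds f L c x k"
proof
  assume "ereal c < dcusum f L x k"
  then obtain v1 d where v1: "1 \<le> v1" "v1 \<le> k" and c: "ereal c < ext_ln (lik_ratio f L x k v1 d)"
    by (auto simp: dcusum_def less_SUP_iff)
  obtain s where s: "s \<in> active_paths L k" "lik_ratio f L x k v1 d = path_lik f s x k"
    using path_of_change_points[OF v1 L] by metis
  have "0 \<le> path_lik f s x k"
    using f active_paths_le[OF s(1)] by (intro path_lik_nonneg[where L = L]) auto
  then show "exceeds f L c x k"
    using c s by (auto simp: exceeds_def ext_ln_greater_iff)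
next
  assume "exceeds f L c x k"
  then obtain s where s: "s \<in> active_paths L k" "exp c < path_lik f s x k"
    by (auto simp: exceeds_def)
  obtain v1 d where v1: "1 \<le> v1" "v1 \<le> k" and d: "d \<in> {1..<L} \<rightarrow>\<^sub>E (UNIV :: nat set)"
    and eq: "lik_ratio f L x k v1 d = path_lik f s x k"
    using change_points_of_path[OF s(1) k] by metis
  have "0 \<le> path_lik f s x k"
    using f active_paths_le[OF s(1)] by (intro path_lik_nonneg[where L = L]) auto
  then have "ereal c < ext_ln (lik_ratio f L x k v1 d)"
    using s(2) by (simp add: eq ext_ln_greater_iff)
  then show "ereal c < dcusum f L x k"
    using v1 d by (auto simp: dcusum_def less_SUP_iff)
qed

text \<open>
  After a time \<open>k\<close> with nonpositive statistic, the part of a path up to \<open>k\<close> contributes a factor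
  at most 1, so dropping it can only increase the likelihood ratio.
\<close>

lemma exceeds_shift:
  assumes f: "\<And>i j. i \<le> L \<Longrightarrow> j \<in> {1..k + m} \<Longrightarrow> 0 \<le> f i (x j)"
    and k: "k = 0 \<or> \<not> exceeds f L 0 x k" and m: "1 \<le> m"
    and ex: "exceeds f L c x (k + m)"
  shows "exceeds f L c (\<lambda>j. x (j + k)) m"
proof -
  obtain s where s: "s \<in> active_paths L (k + m)" "exp c < path_lik f s x (k + m)"
    using ex by (auto simp: exceeds_def)
  define t where "t = (\<lambda>j\<in>{1..m}. s (j + k))"
  have t: "t \<in> active_paths L m"
    using s(1) m active_paths_le[OF s(1)] active_paths_mono[OF s(1)]
    by (auto simp: t_def active_paths_def state_paths_def mono_on_def add.commute)
  have "{1..k + m} = {1..k} \<union> {k + 1..k + m}" by auto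
  then have "path_lik f s x (k + m) =
      path_lik f s x k * (\<Prod>j\<in>{k + 1..k + m}. score f (s j) (x j))"
    unfolding path_lik_def by (simp add: prod.union_disjoint)
  also have "(\<Prod>j\<in>{k + 1..k + m}. score f (s j) (x j)) = path_lik f t (\<lambda>j. x (j + k)) m"
    unfolding path_lik_def t_def
    by (rule prod.reindex_bij_witness[of _ "\<lambda>j. j + k" "\<lambda>j. j - k"]) auto
  finally have split: "path_lik f s x (k + m) =
      path_lik f s x k * path_lik f t (\<lambda>j. x (j + k)) m" .
  \<comment> \<open>If \<open>s k = 0\<close>, the path is constantly 0 up to \<open>k\<close> and
    its factor is 1; otherwise its restriction is active and the condition at \<open>k\<close>
    applies.\<close>
  have "path_lik f s x k \<le> 1"
  proof (cases "k = 0 \<or> s k = 0")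
    case True
    then have "s j = 0" if "j \<in> {1..k}" for j
      using active_paths_mono[OF s(1), of j k] that by auto
    then show ?thesis by (simp add: path_lik_def score_def)
  next
    case False
    then have "restrict s {1..k} \<in> active_paths L k"
      using active_paths_le[OF s(1)] active_paths_mono[OF s(1)]
      by (auto simp: active_paths_def state_paths_def mono_on_def)
    then have "path_lik f (restrict s {1..k}) x k \<le> 1"
      using k False by (auto simp: exceeds_def not_less)
    then show ?thesis
      using path_lik_cong[of k s "restrict s {1..k}" x x f] by simp
  qed
  moreover have "0 \<le> path_lik f t (\<lambda>j. x (j + k)) m"
    using f active_paths_le[OF t] by (intro path_lik_nonneg[where L = L]) auto
  ultimately have "path_lik f s x (k + m) \<le> path_lik f t (\<lambda>j. x (j + k)) m"
    using split mult_right_mono[of "path_lik f s x k" 1] by simp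
  then show ?thesis using s(2) t unfolding exceeds_def by (meson less_le_trans)
qed

section \<open>Counting paths\<close>

text \<open>Pascal's rule: a path ending in \<open>L\<close> is determined by its first
  \<open>k - 1\<close> states, and by monotonicity any other path stays in
  \<open>{0..L - 1}\<close>.\<close>

lemma card_state_paths_le: "card (state_paths L k) \<le> (k + L) choose L"
proof (induction "k + L" arbitrary: k L rule: less_induct)
  case less
  show ?case
  proof (cases "k = 0 \<or> L = 0")
    case True
    have "state_paths L k \<subseteq> {\<lambda>j\<in>{1..k}. 0}"
      using True by (auto simp: state_paths_def PiE_def Pi_iff extensional_def fun_eq_iff)
    then have "card (state_paths L k) \<le> 1" by (metis card_mono card.empty finite.emptyI finite_insert card_insert_disjoint empty_iff One_nat_def)
    then show ?thesis using True by auto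
  next
    case False
    then obtain m l where ml: "k = Suc m" "L = Suc l" by (metis not0_implies_Suc)
    have sub: "state_paths L k \<subseteq> state_paths l k \<union> (\<lambda>s. s(k := L)) ` state_paths L m"
    proof
      fix s assume s: "s \<in> state_paths L k"
      show "s \<in> state_paths l k \<union> (\<lambda>s. s(k := L)) ` state_paths L m"
      proof (cases "s k = L")
        case True
        have "s = (restrict s {1..m})(k := L)"
          using s True by (auto simp: fun_eq_iff ml state_paths_def PiE_def extensional_def)
        moreover have "restrict s {1..m} \<in> state_paths L m"
          using s by (auto simp: ml state_paths_def mono_on_def PiE_iff)
        ultimately show ?thesis by blast
      next
        case False
        have "s j \<le> l" if "j \<in> {1..k}" for j
        proof -
          have "s j \<le> s k" "s k \<le> L"
            using s that by (auto simp: state_paths_def mono_on_def PiE_iff)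
          then show ?thesis using False ml by auto
        qed
        then show ?thesis using s by (auto simp: state_paths_def PiE_iff)
      qed
    qed
    have "card (state_paths L k) \<le> card (state_paths l k \<union> (\<lambda>s. s(k := L)) ` state_paths L m)"
      using sub finite_state_paths by (intro card_mono) auto
    also have "\<dots> \<le> card (state_paths l k) + card (state_paths L m)"
      by (rule order.trans[OF card_Un_le add_left_mono[OF card_image_le[OF finite_state_paths]]])
    also have "\<dots> \<le> ((k + l) choose l) + ((m + L) choose L)"
      using less[of k l] less[of m L] ml by auto
    also have "\<dots> = (k + L) choose L" by (simp add: ml)
    finally show ?thesis .
  qed
qed

text \<open>The constant path 0 is a state path that is not active. Saving this one path matters:
  for \<open>L = 1\<close> the later comparison with \<open>k ^ L\<close> is an equality.\<close>

lemma card_active_paths_le: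
  assumes "1 \<le> k"
  shows "card (active_paths L k) \<le> ((k + L) choose L) - 1"
proof -
  have "(\<lambda>j\<in>{1..k}. 0) \<in> state_paths L k - active_paths L k"
    using assms by (auto simp: state_paths_def active_paths_def mono_on_def)
  moreover have "active_paths L k \<subseteq> state_paths L k" by (auto simp: active_paths_def)
  ultimately have "card (active_paths L k) < card (state_paths L k)"
    using finite_state_paths by (intro psubset_card_mono) auto
  then show ?thesis using card_state_paths_le[of L k] by linarith
qed

text \<open>The bound fails for \<open>k \<le> 2\<close>, whence the separate base case of the sum below.\<close>

lemma choose_le_power:
  assumes k: "3 \<le> k" and L: "1 \<le> L"
  shows "((k + L) choose L) - 1 \<le> k ^ L"
proof (cases "L = 1")
  case False
  then have "2 \<le> L" using L by simp
  then have "(k + L) choose L \<le> k ^ L + 1"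
  proof (induction L rule: dec_induct)
    case base
    have "(k + 2) * (k + 1) \<le> 2 * (k\<^sup>2 + 1)"
    proof -
      define q where "q = k * k"
      have "3 * k \<le> q" unfolding q_def using k by (rule mult_le_mono1)
      then have "q + 3 * k + 2 \<le> 2 * (q + 1)" by simp
      moreover have "(k + 2) * (k + 1) = q + 3 * k + 2" by (simp add: q_def algebra_simps)
      ultimately show ?thesis by (simp only: power2_eq_square q_def)
    qed
    then show ?case by (simp add: choose_two)
  next
    case (step n)
    define p where "p = k ^ n"
    have p: "1 \<le> p" using k by (simp add: p_def)
    \<comment> \<open>Each of \<open>Suc n * p\<close>, \<open>k * p\<close> and \<open>k\<close> is
      at most a third of \<open>Suc n * (k * p)\<close>, the first by \<open>k \<ge> 3\<close> and
      the others by \<open>n \<ge> 2\<close>, so together they are absorbed.\<close>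
    have 1: "3 * (Suc n * p) \<le> Suc n * (k * p)"
      using mult_right_mono[OF k, of "Suc n * p"] by (simp add: algebra_simps)
    have 2: "3 * (k * p) \<le> Suc n * (k * p)"
      using step by (intro mult_right_mono) auto
    have 3: "k \<le> k * p" using p by simp
    have "Suc n * ((k + Suc n) choose Suc n) = (k + Suc n) * ((k + n) choose n)"
      using Suc_times_binomial[of n "k + n"] by simp
    also have "\<dots> \<le> (k + Suc n) * (p + 1)"
      using step by (intro mult_left_mono) (auto simp: p_def)
    also have "\<dots> = k * p + Suc n * p + k + Suc n" by (simp add: algebra_simps)
    also have "\<dots> \<le> Suc n * (k * p) + Suc n" using 1 2 3 by linarith
    also have "\<dots> = Suc n * (k ^ Suc n + 1)" by (simp add: p_def algebra_simps)
    finally show ?case by (simp only: mult_le_cancel1)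
  qed
  then show ?thesis by simp
qed simp

text \<open>Beyond \<open>n = 2\<close> the new term is at most \<open>Suc n ^ L\<close>, and
  \<open>n ^ (L + 1) + Suc n ^ L \<le> Suc n ^ (L + 1)\<close>. The base case bounds the terms for
  \<open>k = 1\<close> and \<open>k = 2\<close> jointly.\<close>

lemma sum_choose_le_power:
  assumes n: "2 \<le> n" and L: "1 \<le> L"
  shows "(\<Sum>k\<in>{1..n}. ((k + L) choose L) - 1) \<le> n ^ (L + 1)"
  using n
proof (induction n rule: dec_induct)
  case base
  \<comment> \<open>Twice the base case, free of division and truncated subtraction.\<close>
  have "2 * L + (L + 2) * (L + 1) \<le> 2 * 2 ^ (L + 1) + 2"
  proof (cases "L = 1")
    case False
    then have "2 \<le> L" using L by simp
    then show ?thesis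
    proof (induction L rule: dec_induct)
      case (step n)
      \<comment> \<open>Passing from \<open>n\<close> to \<open>Suc n\<close> turns the right-hand
        side \<open>a\<close> of the claim into \<open>2 * a - 2\<close>; for
        \<open>n \<ge> 2\<close> the left-hand side grows no faster.\<close>
      have "2 * Suc n + (Suc n + 2) * (Suc n + 1) \<le> 2 * (2 * n + (n + 2) * (n + 1)) - 2"
        using mult_le_mono[OF step(1) step(1)] step(1) by (simp add: algebra_simps)
      with step show ?case by simp
    qed simp
  qed simp
  moreover have "(2 + L) choose L = (L + 2) * (L + 1) div 2"
    using binomial_symmetric[of L "2 + L"] by (simp add: choose_two mult.commute)
  moreover have "(\<Sum>k\<in>{1..2}. ((k + L) choose L) - 1) = L + (((2 + L) choose L) - 1)"
    by (simp add: numeral_2_eq_2)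
  moreover have "l + (a div 2 - 1) \<le> p" if "2 * l + a \<le> 2 * p + 2" "1 \<le> a div 2" for l a p :: nat
    using that by linarith
  ultimately show ?case by simp
next
  case (step n)
  have "(\<Sum>k\<in>{1..Suc n}. ((k + L) choose L) - 1) \<le> n ^ (L + 1) + Suc n ^ L"
    using step choose_le_power[of "Suc n" L] L by simp
  also have "n ^ (L + 1) \<le> n * Suc n ^ L"
    by (simp add: power_mono)
  finally show ?case by simp
qed

section \<open>Observations without change\<close>

lemma enat_less_Inf_iff: "enat n < Inf {enat k | k. Q k} \<longleftrightarrow> (\<forall>k\<le>n. \<not> Q k)"
proof -
  have "enat n < Inf {enat k | k. Q k} \<longleftrightarrow> enat (Suc n) \<le> Inf {enat k | k. Q k}"
    using Suc_ile_eq by blast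
  also have "\<dots> \<longleftrightarrow> (\<forall>k. Q k \<longrightarrow> Suc n \<le> k)"
    by (auto simp: le_Inf_iff)
  also have "\<dots> \<longleftrightarrow> (\<forall>k\<le>n. \<not> Q k)"
    by (meson Suc_le_eq not_le)
  finally show ?thesis .
qed

lemma sum_indicator_le_enat:
  "(\<Sum>k<n. indicator {k. enat k < t} k) \<le> ennreal_of_enat t"
proof (cases t)
  case (enat m)
  have "(\<Sum>k<n. indicator {k. enat k < t} k) = ennreal (real (card {k \<in> {..<n}. k < m}))"
    by (simp add: enat indicator_def sum.If_cases ennreal_of_nat_eq_real_of_nat Collect_conj_eq lessThan_def)
  also have "card {k \<in> {..<n}. k < m} \<le> card {..<m}"
    by (intro card_mono) auto
  finally show ?thesis by (simp add: enat ennreal_of_nat_eq_real_of_nat)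
qed simp

locale iid_observations = prob_space P for P :: "'w measure" +
  fixes M :: "'a measure" and f :: "nat \<Rightarrow> 'a \<Rightarrow> real" and L :: nat and X :: "nat \<Rightarrow> 'w \<Rightarrow> 'a"
  assumes L: "1 \<le> L"
    and dens: "i \<le> L \<Longrightarrow> is_prob_density M (f i)"
    and indep: "indep_vars (\<lambda>_. M) X {1..}"
    and distr_X: "1 \<le> k \<Longrightarrow> distributed P M (X k) (\<lambda>x. ennreal (f 0 x))"
begin

section \<open>Measurability and mean likelihood ratios under no change\<close>

lemma measurable_X: "1 \<le> k \<Longrightarrow> X k \<in> measurable P M"
  using distr_X distributed_def by blast

lemma f_nonneg: "i \<le> L \<Longrightarrow> 1 \<le> j \<Longrightarrow> w \<in> space P \<Longrightarrow> 0 \<le> f i (X j w)"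
  using dens[of i] measurable_space[OF measurable_X[of j]] by (auto simp: is_prob_density_def)

lemma measurable_score: "i \<le> L \<Longrightarrow> score f i \<in> borel_measurable M"
  using dens[of i] dens[of 0] by (auto simp: score_def[abs_def] is_prob_density_def)

text \<open>The index set is general because both the finite past \<open>{1..k}\<close> and the
  infinite future \<open>{1..}\<close> occur.\<close>

lemma pred_exceeds:
  assumes "{1..k} \<subseteq> I"
  shows "Measurable.pred (PiM I (\<lambda>_. M)) (\<lambda>x. exceeds f L c x k)"
proof -
  have "(\<lambda>x. path_lik f s x k) \<in> borel_measurable (PiM I (\<lambda>_. M))" if s: "s \<in> active_paths L k" for s
    unfolding path_lik_def
  proof (rule borel_measurable_prod)
    fix j assume j: "j \<in> {1..k}"
    then have "(\<lambda>x. x j) \<in> measurable (PiM I (\<lambda>_. M)) M"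
      using assms by (intro measurable_component_singleton) auto
    then show "(\<lambda>x. score f (s j) (x j)) \<in> borel_measurable (PiM I (\<lambda>_. M))"
      using measurable_score[OF active_paths_le[OF s j]] by (rule measurable_compose)
  qed
  then show ?thesis
    unfolding exceeds_def by (intro pred_intros_finite finite_active_paths) measurable
qed

lemma pred_exceeds_X [measurable]: "Measurable.pred P (\<lambda>w. exceeds f L c (\<lambda>j. X j w) k)"
proof -
  \<comment> \<open>The assumptions concern \<open>X j\<close> for \<open>j \<ge> 1\<close>, so the
    sequence is restricted before it enters a product space.\<close>
  have "(\<lambda>w. \<lambda>j\<in>{1..k}. X j w) \<in> measurable P (PiM {1..k} (\<lambda>_. M))"
    using measurable_X by (intro measurable_restrict) auto
  from measurable_compose[OF this pred_exceeds[OF order.refl]]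
  have "Measurable.pred P (\<lambda>w. exceeds f L c (\<lambda>j\<in>{1..k}. X j w) k)" .
  moreover have "exceeds f L c (\<lambda>j\<in>{1..k}. X j w) k \<longleftrightarrow> exceeds f L c (\<lambda>j. X j w) k" for w
    by (intro exceeds_cong) auto
  ultimately show ?thesis by simp
qed

text \<open>For \<open>i \<ge> 1\<close> the product \<open>f 0 * (f i / f 0)\<close> is
  \<open>f i\<close> where \<open>f 0\<close> is nonzero and 0 elsewhere, so only mass of
  \<open>f i\<close> on the zeros of \<open>f 0\<close> is lost.\<close>

lemma nn_integral_score_le:
  assumes "i \<le> L" "1 \<le> j"
  shows "(\<integral>\<^sup>+ w. ennreal (score f i (X j w)) \<partial>P) \<le> 1"
proof -
  have "(\<integral>\<^sup>+ w. ennreal (score f i (X j w)) \<partial>P) =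
      (\<integral>\<^sup>+ y. ennreal (f 0 y) * ennreal (score f i y) \<partial>M)"
    using measurable_score[OF assms(1)]
    by (intro distributed_nn_integral[OF distr_X[OF assms(2)], symmetric]) measurable
  also have "\<dots> \<le> (\<integral>\<^sup>+ y. ennreal (f i y) \<partial>M)"
  proof (rule nn_integral_mono)
    fix y assume "y \<in> space M"
    then have "0 \<le> f 0 y" "0 \<le> f i y"
      using dens[of 0] dens[OF assms(1)] by (auto simp: is_prob_density_def)
    then show "ennreal (f 0 y) * ennreal (score f i y) \<le> ennreal (f i y)"
      by (auto simp: score_def simp flip: ennreal_mult)
  qed
  also have "\<dots> = 1" using dens[OF assms(1)] by (simp add: is_prob_density_def)
  finally show ?thesis .
qed

lemma nn_integral_path_lik_le:
  assumes s: "s \<in> active_paths L k"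
  shows "(\<integral>\<^sup>+ w. ennreal (path_lik f s (\<lambda>j. X j w) k) \<partial>P) \<le> 1"
proof -
  have "(\<integral>\<^sup>+ w. ennreal (path_lik f s (\<lambda>j. X j w) k) \<partial>P) =
      (\<integral>\<^sup>+ w. (\<Prod>j\<in>{1..k}. ennreal (score f (s j) (X j w))) \<partial>P)"
    unfolding path_lik_def
  proof (intro nn_integral_cong prod_ennreal[symmetric])
    fix w j assume "w \<in> space P" "j \<in> {1..k}"
    then show "0 \<le> score f (s j) (X j w)"
      using f_nonneg active_paths_le[OF s] by (auto simp: score_def)
  qed
  also have "\<dots> = (\<Prod>j\<in>{1..k}. \<integral>\<^sup>+ w. ennreal (score f (s j) (X j w)) \<partial>P)"
  proof (rule indep_vars_nn_integral)
    show "indep_vars (\<lambda>_. borel) (\<lambda>j w. ennreal (score f (s j) (X j w))) {1..k}"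
    proof (rule indep_vars_compose2[where M' = "\<lambda>_. M"])
      show "indep_vars (\<lambda>_. M) X {1..k}" by (rule indep_vars_subset[OF indep]) auto
    next
      fix j assume "j \<in> {1..k}"
      then show "(\<lambda>y. ennreal (score f (s j) y)) \<in> borel_measurable M"
        using measurable_score[OF active_paths_le[OF s]] by measurable
    qed
  qed auto
  also have "\<dots> \<le> (\<Prod>j\<in>{1..k}. 1)"
    using nn_integral_score_le active_paths_le[OF s] by (intro prod_mono_ennreal) auto
  finally show ?thesis by simp
qed

text \<open>Markov's inequality for each path, whose likelihood ratio has mean at most 1, and a
  union bound over the paths.\<close>

lemma prob_exceeds_le:
  "prob {w \<in> space P. exceeds f L c (\<lambda>j. X j w) k} \<le> card (active_paths L k) * exp (- c)"
proof -
  have meas: "(\<lambda>w. path_lik f s (\<lambda>j. X j w) k) \<in> borel_measurable P"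
    if s: "s \<in> active_paths L k" for s
    unfolding path_lik_def
    using measurable_compose[OF measurable_X measurable_score[OF active_paths_le[OF s]]]
    by (intro borel_measurable_prod) auto
  have one: "prob {w \<in> space P. exp c < path_lik f s (\<lambda>j. X j w) k} \<le> exp (- c)"
    if s: "s \<in> active_paths L k" for s
  proof -
    let ?u = "\<lambda>w. path_lik f s (\<lambda>j. X j w) k"
    note [measurable] = meas[OF s]
    have "emeasure P {w \<in> space P. exp c < ?u w}
        \<le> emeasure P {w \<in> space P. 1 \<le> ennreal (exp (- c)) * ennreal (?u w)}"
      by (intro emeasure_mono) (auto simp: exp_minus field_simps simp flip: ennreal_mult')
    also have "\<dots> \<le> ennreal (exp (- c)) * (\<integral>\<^sup>+ w. ennreal (?u w) * indicator (space P) w \<partial>P)"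
      by (intro nn_integral_Markov_inequality) auto
    also have "(\<integral>\<^sup>+ w. ennreal (?u w) * indicator (space P) w \<partial>P) = (\<integral>\<^sup>+ w. ennreal (?u w) \<partial>P)"
      by (intro nn_integral_cong) auto
    also have "ennreal (exp (- c)) * \<dots> \<le> ennreal (exp (- c)) * 1"
      by (intro mult_left_mono nn_integral_path_lik_le[OF s]) auto
    finally show ?thesis by (simp add: emeasure_eq_measure)
  qed
  have "{w \<in> space P. exceeds f L c (\<lambda>j. X j w) k} =
      (\<Union>s\<in>active_paths L k. {w \<in> space P. exp c < path_lik f s (\<lambda>j. X j w) k})"
    by (auto simp: exceeds_def)
  also have "prob \<dots> \<le>
      (\<Sum>s\<in>active_paths L k. prob {w \<in> space P. exp c < path_lik f s (\<lambda>j. X j w) k})"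
    using meas by (intro finite_measure_subadditive_finite finite_active_paths) auto
  also have "\<dots> \<le> (\<Sum>s\<in>active_paths L k. exp (- c))"
    by (intro sum_mono one)
  finally show ?thesis by simp
qed

section \<open>Stationarity and independence of past and future\<close>

lemma measurable_shifted_X: "(\<lambda>w. \<lambda>j\<in>{1..}. X (j + k) w) \<in> measurable P (PiM {1..} (\<lambda>_. M))"
  using measurable_X by (intro measurable_restrict) auto

text \<open>Both sequences have the same joint law, the product of copies of the law with density
  \<open>f 0\<close>.\<close>

lemma prob_shift:
  assumes C: "Measurable.pred (PiM {1..} (\<lambda>_. M)) C"
  shows "prob {w \<in> space P. C (\<lambda>j\<in>{1..}. X (j + k) w)} = prob {w \<in> space P. C (\<lambda>j\<in>{1..}. X j w)}"
proof -
  have law: "distr P (PiM {1..} (\<lambda>_. M)) (\<lambda>w. \<lambda>j\<in>{1..}. X (j + l) w) =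
      PiM {1..} (\<lambda>_. density M (\<lambda>x. ennreal (f 0 x)))" for l
  proof -
    \<comment> \<open>Independence is reindexed along \<open>j \<mapsto> j + l\<close> by grouping
      into the disjoint singleton blocks \<open>{j + l}\<close> and projecting.\<close>
    have "indep_vars (\<lambda>j. PiM {j + l} (\<lambda>_. M)) (\<lambda>j w. \<lambda>i\<in>{j + l}. X i w) {1..}"
      by (rule indep_vars_restrict[OF indep]) (auto simp: disjoint_family_on_def)
    then have "indep_vars (\<lambda>_. M) (\<lambda>j w. (\<lambda>i\<in>{j + l}. X i w) (j + l)) {1..}"
      by (rule indep_vars_compose2) (intro measurable_component_singleton, simp)
    then have "indep_vars (\<lambda>_. M) (\<lambda>j. X (j + l)) {1..}" by simp
    then have "distr P (PiM {1..} (\<lambda>_. M)) (\<lambda>w. \<lambda>j\<in>{1..}. X (j + l) w) =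
        PiM {1..} (\<lambda>j. distr P M (X (j + l)))"
      using measurable_X by (subst (asm) indep_vars_iff_distr_eq_PiM') auto
    also have "\<dots> = PiM {1..} (\<lambda>_. density M (\<lambda>x. ennreal (f 0 x)))"
      using distr_X by (intro PiM_cong refl) (auto simp: distributed_def)
    finally show ?thesis .
  qed
  have "prob {w \<in> space P. C (\<lambda>j\<in>{1..}. X (j + l) w)} =
      measure (PiM {1..} (\<lambda>_. density M (\<lambda>x. ennreal (f 0 x)))) {x \<in> space (PiM {1..} (\<lambda>_. M)). C x}" for l
  proof -
    have "{w \<in> space P. C (\<lambda>j\<in>{1..}. X (j + l) w)} =
        (\<lambda>w. \<lambda>j\<in>{1..}. X (j + l) w) -` {x \<in> space (PiM {1..} (\<lambda>_. M)). C x} \<inter> space P"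
      using measurable_space[OF measurable_shifted_X[of l]] by auto
    moreover have "{x \<in> space (PiM {1..} (\<lambda>_. M)). C x} \<in> sets (PiM {1..} (\<lambda>_. M))"
      using C by (simp only: pred_def)
    ultimately show ?thesis
      using measure_distr[OF measurable_shifted_X[of l], unfolded law] by simp
  qed
  from this[of k] this[of 0] show ?thesis by simp
qed

text \<open>Past and future are functions of the disjoint blocks \<open>{1..k}\<close> and
  \<open>{Suc k..}\<close> of independent observations; stationarity then removes the shift from the
  second factor.\<close>

lemma prob_past_future:
  assumes A: "Measurable.pred (PiM {1..k} (\<lambda>_. M)) A" and C: "Measurable.pred (PiM {1..} (\<lambda>_. M)) C"
  shows "prob {w \<in> space P. A (\<lambda>j\<in>{1..k}. X j w) \<and> C (\<lambda>j\<in>{1..}. X (j + k) w)} =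
    prob {w \<in> space P. A (\<lambda>j\<in>{1..k}. X j w)} * prob {w \<in> space P. C (\<lambda>j\<in>{1..}. X j w)}"
proof -
  define past where "past w = (\<lambda>j\<in>{1..k}. X j w)" for w
  define future where "future w = (\<lambda>j\<in>{Suc k..}. X j w)" for w
  define shift :: "(nat \<Rightarrow> 'a) \<Rightarrow> nat \<Rightarrow> 'a" where "shift x = (\<lambda>j\<in>{1..}. x (j + k))" for x
  define SA where "SA = {x \<in> space (PiM {1..k} (\<lambda>_. M)). A x}"
  define SC where "SC = {x \<in> space (PiM {Suc k..} (\<lambda>_. M)). C (shift x)}"
  have "shift \<in> measurable (PiM {Suc k..} (\<lambda>_. M)) (PiM {1..} (\<lambda>_. M))"
    unfolding shift_def[abs_def]
    by (intro measurable_restrict measurable_component_singleton) auto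
  from measurable_compose[OF this C] have SC: "SC \<in> sets (PiM {Suc k..} (\<lambda>_. M))"
    by (simp only: pred_def SC_def)
  have SA: "SA \<in> sets (PiM {1..k} (\<lambda>_. M))"
    using A by (simp only: pred_def SA_def)
  have shift: "shift (future w) = (\<lambda>j\<in>{1..}. X (j + k) w)" for w
    by (auto simp: shift_def future_def)
  have in_SA: "past w \<in> SA \<longleftrightarrow> A (past w)"
    and in_SC: "future w \<in> SC \<longleftrightarrow> C (shift (future w))" if "w \<in> space P" for w
    using measurable_space[OF measurable_X that]
    by (auto simp: SA_def SC_def space_PiM past_def future_def)
  have "indep_var (PiM {1..k} (\<lambda>_. M)) past (PiM {Suc k..} (\<lambda>_. M)) future"
    unfolding past_def[abs_def] future_def[abs_def]
    by (rule indep_var_restrict[OF indep]) auto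
  from indep_varD[OF this SA SC]
  have "prob ((\<lambda>w. (past w, future w)) -` (SA \<times> SC) \<inter> space P) =
      prob (past -` SA \<inter> space P) * prob (future -` SC \<inter> space P)" .
  moreover have "(\<lambda>w. (past w, future w)) -` (SA \<times> SC) \<inter> space P =
      {w \<in> space P. A (past w) \<and> C (shift (future w))}"
    using in_SA in_SC by auto
  moreover have "past -` SA \<inter> space P = {w \<in> space P. A (past w)}"
    using in_SA by auto
  moreover have "future -` SC \<inter> space P = {w \<in> space P. C (shift (future w))}"
    using in_SC by auto
  ultimately have "prob {w \<in> space P. A (past w) \<and> C (shift (future w))} =
      prob {w \<in> space P. A (past w)} * prob {w \<in> space P. C (shift (future w))}"
    by simp
  then show ?thesis
    unfolding shift past_def prob_shift[OF C] .
qed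

section \<open>Cycles between renewal times\<close>

definition cycle_exceeds :: "real \<Rightarrow> (nat \<Rightarrow> 'a) \<Rightarrow> bool" where
  "cycle_exceeds b x \<longleftrightarrow> (\<exists>j\<ge>1. exceeds f L b x j \<and> (\<forall>i\<in>{1..j}. exceeds f L 0 x i))"

lemma cycle_exceeds_restrict: "cycle_exceeds b (\<lambda>j\<in>{1..}. x j) \<longleftrightarrow> cycle_exceeds b x"
proof -
  have "exceeds f L c (\<lambda>j\<in>{1..}. x j) k \<longleftrightarrow> exceeds f L c x k" for c k
    by (intro exceeds_cong) auto
  then show ?thesis by (simp add: cycle_exceeds_def)
qed

lemma pred_cycle_exceeds: "Measurable.pred (PiM {1..} (\<lambda>_. M)) (cycle_exceeds b)"
proof -
  have [measurable]: "Measurable.pred (PiM {1..} (\<lambda>_. M)) (\<lambda>x. exceeds f L c x k)" for c k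
    by (rule pred_exceeds) auto
  show ?thesis unfolding cycle_exceeds_def[abs_def] by measurable
qed

text \<open>Let \<open>u\<close> be the first crossing and \<open>k\<close> the last renewal time
  before it. The statistic is positive from \<open>k + 1\<close> to \<open>u\<close>, and dropping
  the observations up to \<open>k\<close> preserves both this and the crossing.\<close>

lemma exceeds_in_some_cycle:
  assumes b: "0 \<le> b" and w: "w \<in> space P" and t: "1 \<le> t" "t \<le> n" "exceeds f L b (\<lambda>j. X j w) t"
  shows "\<exists>k<n. (\<forall>i\<in>{1..k}. \<not> exceeds f L b (\<lambda>j. X j w) i) \<and> cycle_exceeds b (\<lambda>j. X (j + k) w)
    \<and> (k = 0 \<or> \<not> exceeds f L 0 (\<lambda>j. X j w) k)"
proof -
  define u where "u = (LEAST i. 1 \<le> i \<and> exceeds f L b (\<lambda>j. X j w) i)"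
  have u: "1 \<le> u" "exceeds f L b (\<lambda>j. X j w) u"
    using LeastI[of "\<lambda>i. 1 \<le> i \<and> exceeds f L b (\<lambda>j. X j w) i" t] t by (auto simp: u_def)
  have "u \<le> t" unfolding u_def using t by (intro Least_le) auto
  have least: "\<not> exceeds f L b (\<lambda>j. X j w) i" if "i \<in> {1..<u}" for i
    using not_less_Least[of i "\<lambda>i. 1 \<le> i \<and> exceeds f L b (\<lambda>j. X j w) i"] that by (auto simp: u_def)
  let ?R = "{i \<in> {..<u}. i = 0 \<or> \<not> exceeds f L 0 (\<lambda>j. X j w) i}"
  define k where "k = Max ?R"
  have "0 \<in> ?R" using u by auto
  then have k: "k \<in> ?R" unfolding k_def by (intro Max_in) auto
  \<comment> \<open>At \<open>u\<close> positivity comes from \<open>b \<ge> 0\<close>, strictly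
    between \<open>k\<close> and \<open>u\<close> from the maximality of \<open>k\<close>.\<close>
  have pos: "exceeds f L 0 (\<lambda>j. X j w) i" if "k < i" "i \<le> u" for i
  proof (cases "i = u")
    case True
    have "exp 0 \<le> exp b" using b by simp
    with u(2) show ?thesis unfolding True exceeds_def by (meson le_less_trans)
  next
    case False
    show ?thesis
    proof (rule ccontr)
      assume "\<not> exceeds f L 0 (\<lambda>j. X j w) i"
      then have "i \<le> k" unfolding k_def using that False by (intro Max_ge) auto
      then show False using that by simp
    qed
  qed
  have shift: "exceeds f L c (\<lambda>j. X (j + k) w) m"
    if "1 \<le> m" "exceeds f L c (\<lambda>j. X j w) (k + m)" for c m
    using k w that f_nonneg by (intro exceeds_shift) auto
  have "cycle_exceeds b (\<lambda>j. X (j + k) w)"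
    unfolding cycle_exceeds_def
  proof (intro exI[of _ "u - k"] conjI ballI)
    show "exceeds f L b (\<lambda>j. X (j + k) w) (u - k)" using k u by (intro shift) auto
    show "exceeds f L 0 (\<lambda>j. X (j + k) w) i" if "i \<in> {1..u - k}" for i
      using k that by (intro shift pos) auto
  qed (use k in auto)
  moreover have "k < n" using k \<open>u \<le> t\<close> t by auto
  ultimately show ?thesis using k least by (intro exI[of _ k]) auto
qed

text \<open>The probability that the stopping time is larger than \<open>n\<close>, by
  \<open>less_dcusum_time_iff\<close>.\<close>

definition survival :: "real \<Rightarrow> nat \<Rightarrow> real" where
  "survival b n = prob {w \<in> space P. \<forall>i\<in>{1..n}. \<not> exceeds f L b (\<lambda>j. X j w) i}"

definition cycle_prob :: "real \<Rightarrow> real" where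
  "cycle_prob b = prob {w \<in> space P. cycle_exceeds b (\<lambda>j. X j w)}"

lemma sets_survival: "{w \<in> space P. \<forall>i\<in>{1..n}. \<not> exceeds f L b (\<lambda>j. X j w) i} \<in> events"
  by measurable

text \<open>Crossings by time \<open>n\<close> are sorted by the renewal time \<open>k < n\<close>
  that opens their cycle. The conditions up to \<open>k\<close> concern the past and the cycle
  concerns the future, so independence gives each probability as a product.\<close>

lemma one_minus_survival_le:
  assumes b: "0 \<le> b"
  shows "1 - survival b n \<le> cycle_prob b * (\<Sum>k<n. survival b k)"
proof -
  define A where "A k x \<longleftrightarrow> (\<forall>i\<in>{1..k}. \<not> exceeds f L b x i) \<and> (k = 0 \<or> \<not> exceeds f L 0 x k)" for k x
  have A_restrict: "A k (\<lambda>j\<in>{1..k}. x j) \<longleftrightarrow> A k x" for k x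
  proof -
    have "exceeds f L c (\<lambda>j\<in>{1..k}. x j) i \<longleftrightarrow> exceeds f L c x i" if "i \<le> k" for c i
      using that by (intro exceeds_cong) auto
    then show ?thesis by (auto simp: A_def)
  qed
  have A: "Measurable.pred (PiM {1..k} (\<lambda>_. M)) (A k)" for k
  proof -
    have "Measurable.pred (PiM {1..k} (\<lambda>_. M)) (\<lambda>x. exceeds f L c x i)" if "i \<le> k" for c i
      using that by (intro pred_exceeds) auto
    then show ?thesis unfolding A_def[abs_def]
      by (intro pred_intros_logic pred_intros_finite) auto
  qed
  let ?E = "\<lambda>k. {w \<in> space P. A k (\<lambda>j. X j w) \<and> cycle_exceeds b (\<lambda>j. X (j + k) w)}"
  have E: "prob (?E k) = prob {w \<in> space P. A k (\<lambda>j. X j w)} * cycle_prob b" for k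
    using prob_past_future[OF A[of k] pred_cycle_exceeds[of b]]
    by (simp only: A_restrict cycle_exceeds_restrict cycle_prob_def)
  have E_sets: "?E k \<in> events" for k
  proof -
    have "(\<lambda>w. \<lambda>j\<in>{1..k}. X j w) \<in> measurable P (PiM {1..k} (\<lambda>_. M))"
      using measurable_X by (intro measurable_restrict) auto
    from measurable_compose[OF this A]
      measurable_compose[OF measurable_shifted_X[of k] pred_cycle_exceeds[of b]]
    have "Measurable.pred P (\<lambda>w. A k (\<lambda>j. X j w))" "Measurable.pred P (\<lambda>w. cycle_exceeds b (\<lambda>j. X (j + k) w))"
      by (simp_all only: A_restrict cycle_exceeds_restrict)
    then show ?thesis by measurable
  qed
  have "1 - survival b n = prob (space P - {w \<in> space P. \<forall>i\<in>{1..n}. \<not> exceeds f L b (\<lambda>j. X j w) i})"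
    unfolding survival_def by (rule prob_compl[OF sets_survival, symmetric])
  also have "\<dots> \<le> prob (\<Union>k<n. ?E k)"
  proof (rule finite_measure_mono)
    show "space P - {w \<in> space P. \<forall>i\<in>{1..n}. \<not> exceeds f L b (\<lambda>j. X j w) i} \<subseteq> (\<Union>k<n. ?E k)"
    proof
      fix w assume "w \<in> space P - {w \<in> space P. \<forall>i\<in>{1..n}. \<not> exceeds f L b (\<lambda>j. X j w) i}"
      then obtain t where w: "w \<in> space P" and t: "1 \<le> t" "t \<le> n" "exceeds f L b (\<lambda>j. X j w) t"
        by auto
      from exceeds_in_some_cycle[OF b w t] obtain k where
        "k < n" "A k (\<lambda>j. X j w)" "cycle_exceeds b (\<lambda>j. X (j + k) w)"
        unfolding A_def by blast
      then show "w \<in> (\<Union>k<n. ?E k)" using w by blast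
    qed
  qed (use E_sets in auto)
  also have "\<dots> \<le> (\<Sum>k<n. prob (?E k))"
    using E_sets by (intro finite_measure_subadditive_finite) auto
  \<comment> \<open>The renewal condition in \<open>A k\<close> is dropped, leaving the event of no
    crossing up to \<open>k\<close>.\<close>
  also have "\<dots> \<le> (\<Sum>k<n. survival b k * cycle_prob b)"
    unfolding E survival_def cycle_prob_def
    by (intro sum_mono mult_right_mono finite_measure_mono sets_survival) (auto simp: A_def)
  finally show ?thesis by (simp add: sum_distrib_left mult.commute)
qed

section \<open>Stopping times, expectation and the bound for one cycle\<close>

lemma less_dcusum_time_iff:
  assumes "w \<in> space P"
  shows "enat n < dcusum_time f L b (\<lambda>j. X j w) \<longleftrightarrow> (\<forall>i\<in>{1..n}. \<not> exceeds f L b (\<lambda>j. X j w) i)"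
proof -
  have "ereal b < dcusum f L (\<lambda>j. X j w) k \<longleftrightarrow> exceeds f L b (\<lambda>j. X j w) k" if "1 \<le> k" for k
    using that assms L f_nonneg by (intro dcusum_greater_iff) auto
  then show ?thesis unfolding dcusum_time_def enat_less_Inf_iff by auto
qed

text \<open>Cycle lengths are integers or infinite, so exceeding a real \<open>m \<ge> 0\<close> is
  the same as exceeding its floor.\<close>

lemma less_dcusum_zero_time_iff:
  assumes "w \<in> space P" "0 \<le> m"
  shows "ereal m < ereal_of_enat (dcusum_zero_time f L (\<lambda>j. X j w)) \<longleftrightarrow>
    (\<forall>i\<in>{1..nat \<lfloor>m\<rfloor>}. exceeds f L 0 (\<lambda>j. X j w) i)"
proof -
  have pos: "0 < dcusum f L (\<lambda>j. X j w) k \<longleftrightarrow> exceeds f L 0 (\<lambda>j. X j w) k" if "1 \<le> k" for k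
    unfolding zero_ereal_def using that assms L f_nonneg by (intro dcusum_greater_iff) auto
  have "max (dcusum f L (\<lambda>j. X j w) k) 0 = 0 \<longleftrightarrow> \<not> exceeds f L 0 (\<lambda>j. X j w) k" if "1 \<le> k" for k
    unfolding pos[OF that, symmetric] by (auto simp: max_def)
  then have "enat n < dcusum_zero_time f L (\<lambda>j. X j w) \<longleftrightarrow> (\<forall>i\<in>{1..n}. exceeds f L 0 (\<lambda>j. X j w) i)" for n
    unfolding dcusum_zero_time_def enat_less_Inf_iff by auto
  moreover have "ereal m < ereal_of_enat y \<longleftrightarrow> enat (nat \<lfloor>m\<rfloor>) < y" for y
    using assms(2) by (cases y) (auto simp: nat_less_iff floor_less_iff)
  ultimately show ?thesis by simp
qed

text \<open>The tail-sum formula for an expectation, truncated at \<open>n\<close>.\<close>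

lemma sum_survival_le:
  "ennreal (\<Sum>k<n. survival b k) \<le> (\<integral>\<^sup>+ w. ennreal_of_enat (dcusum_time f L b (\<lambda>j. X j w)) \<partial>P)"
proof -
  let ?H = "\<lambda>k. {w \<in> space P. \<forall>i\<in>{1..k}. \<not> exceeds f L b (\<lambda>j. X j w) i}"
  have "ennreal (\<Sum>k<n. survival b k) = (\<Sum>k<n. emeasure P (?H k))"
    by (simp add: survival_def emeasure_eq_measure sum_ennreal)
  also have "\<dots> = (\<integral>\<^sup>+ w. (\<Sum>k<n. indicator (?H k) w) \<partial>P)"
    using sets_survival by (subst nn_integral_sum) auto
  also have "\<dots> \<le> (\<integral>\<^sup>+ w. ennreal_of_enat (dcusum_time f L b (\<lambda>j. X j w)) \<partial>P)"
  proof (rule nn_integral_mono)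
    fix w assume w: "w \<in> space P"
    have "(\<Sum>k<n. indicator (?H k) w) =
        (\<Sum>k<n. indicator {k. enat k < dcusum_time f L b (\<lambda>j. X j w)} k :: ennreal)"
      using w by (intro sum.cong) (auto simp: indicator_def less_dcusum_time_iff)
    then show "(\<Sum>k<n. indicator (?H k) w) \<le> ennreal_of_enat (dcusum_time f L b (\<lambda>j. X j w))"
      using sum_indicator_le_enat by simp
  qed
  finally show ?thesis .
qed

text \<open>An infinite expectation is trivial. Otherwise the survival probabilities are summable
  and tend to 0, and the limit of \<open>1 - survival b n \<le> q * I\<close> is
  \<open>1 \<le> q * I\<close>.\<close>

lemma expectation_dcusum_time_ge:
  assumes b: "0 \<le> b" and q: "cycle_prob b \<le> q" "0 < q"
  shows "ennreal (1 / q) \<le> (\<integral>\<^sup>+ w. ennreal_of_enat (dcusum_time f L b (\<lambda>j. X j w)) \<partial>P)"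
    (is "_ \<le> ?I")
proof (cases "?I = \<infinity>")
  case False
  define I where "I = enn2real ?I"
  have I: "?I = ennreal I" "0 \<le> I" using False by (auto simp: I_def less_top)
  have nonneg: "0 \<le> survival b k" for k by (simp add: survival_def)
  have S: "(\<Sum>k<n. survival b k) \<le> I" for n
    using sum_survival_le[of b n] I by simp
  have "summable (survival b)"
    by (rule summableI_nonneg_bounded[OF nonneg S])
  then have "(\<lambda>n. 1 - survival b n) \<longlonglongrightarrow> 1 - 0"
    by (intro tendsto_diff tendsto_const summable_LIMSEQ_zero)
  moreover have "1 - survival b n \<le> q * I" for n
  proof -
    have "cycle_prob b * (\<Sum>k<n. survival b k) \<le> q * I"
      using q S[of n] nonneg by (intro mult_mono sum_nonneg) auto
    then show ?thesis using one_minus_survival_le[OF b, of n] by simp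
  qed
  ultimately have "1 \<le> q * I" by (intro LIMSEQ_le_const2) auto
  then show ?thesis using q I by (simp add: field_simps)
qed simp

lemma cycle_prob_le:
  assumes \<alpha>: "0 < \<alpha>" and b: "0 < b"
    and tail: "\<And>m :: real. 1 \<le> m \<Longrightarrow>
      prob {w \<in> space P. ereal_of_enat (dcusum_zero_time f L (\<lambda>j. X j w)) > ereal m} \<le> exp (- \<alpha> * m)"
  shows "cycle_prob b \<le> exp (- b) * (1 + (b / \<alpha>) ^ (L + 1))"
proof -
  define Z where "Z n = {w \<in> space P. \<forall>i\<in>{1..n}. exceeds f L 0 (\<lambda>j. X j w) i}" for n
  define B where "B k = {w \<in> space P. exceeds f L b (\<lambda>j. X j w) k}" for k
  have Z_sets: "Z n \<in> events" for n
    unfolding Z_def by measurable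
  have B_sets: "B k \<in> events" for k
    unfolding B_def by measurable
  have Z: "prob (Z (nat \<lfloor>m\<rfloor>)) \<le> exp (- \<alpha> * m)" if "1 \<le> m" for m
  proof -
    have "{w \<in> space P. ereal_of_enat (dcusum_zero_time f L (\<lambda>j. X j w)) > ereal m} = Z (nat \<lfloor>m\<rfloor>)"
      unfolding Z_def using that by (intro Collect_cong conj_cong refl less_dcusum_zero_time_iff) auto
    then show ?thesis using tail[OF that] by simp
  qed
  define m where "m = b / \<alpha>"
  have m: "0 < m" "\<alpha> * m = b" using \<alpha> b by (auto simp: m_def)
  show ?thesis
  proof (cases "m < 2")
    case True
    \<comment> \<open>The tail hypothesis starts at 1, hence the maximum. Since
      \<open>l < 2\<close>, the event is that the statistic is positive at time 1, as in every cycle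
      with a crossing.\<close>
    define l where "l = max 1 m"
    have "nat \<lfloor>l\<rfloor> = 1"
    proof -
      have "\<lfloor>l\<rfloor> = 1" using True by (simp add: floor_eq_iff l_def)
      then show ?thesis by simp
    qed
    then have "cycle_prob b \<le> prob (Z (nat \<lfloor>l\<rfloor>))"
      unfolding cycle_prob_def
      by (intro finite_measure_mono Z_sets) (auto simp: Z_def cycle_exceeds_def)
    also have "\<dots> \<le> exp (- \<alpha> * l)" by (rule Z) (simp add: l_def)
    also have "\<dots> \<le> exp (- b)"
      using \<alpha> m mult_left_mono[of m l \<alpha>] by (simp add: l_def)
    also have "\<dots> \<le> exp (- b) * (1 + m ^ (L + 1))"
      using m by simp
    finally show ?thesis by (simp add: m_def)
  next
    case False
    \<comment> \<open>A crossing after \<open>n\<close> needs a cycle longer than \<open>n\<close>;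
      a crossing by \<open>n\<close> is covered by paths of length at most \<open>n\<close>.\<close>
    define n where "n = nat \<lfloor>m\<rfloor>"
    have n: "2 \<le> n" "real n \<le> m" using False m by (auto simp: n_def le_nat_iff le_floor_iff)
    have "cycle_prob b \<le> prob (Z n \<union> (\<Union>k\<in>{1..n}. B k))"
      unfolding cycle_prob_def
    proof (rule finite_measure_mono)
      show "{w \<in> space P. cycle_exceeds b (\<lambda>j. X j w)} \<subseteq> Z n \<union> (\<Union>k\<in>{1..n}. B k)"
      proof
        fix w assume "w \<in> {w \<in> space P. cycle_exceeds b (\<lambda>j. X j w)}"
        then obtain j where w: "w \<in> space P" and j: "1 \<le> j" "exceeds f L b (\<lambda>j. X j w) j"
          "\<And>i. i \<in> {1..j} \<Longrightarrow> exceeds f L 0 (\<lambda>j. X j w) i"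
          by (auto simp: cycle_exceeds_def)
        show "w \<in> Z n \<union> (\<Union>k\<in>{1..n}. B k)"
        proof (cases "j \<le> n")
          case True
          then have "w \<in> B j" "j \<in> {1..n}" using w j by (auto simp: B_def)
          then show ?thesis by blast
        next
          case False
          then have "w \<in> Z n" using w j(3) by (auto simp: Z_def)
          then show ?thesis by blast
        qed
      qed
    qed (use Z_sets B_sets in auto)
    also have "\<dots> \<le> prob (Z n) + (\<Sum>k\<in>{1..n}. prob (B k))"
      using Z_sets B_sets
      by (intro order.trans[OF measure_Un_le] add_left_mono finite_measure_subadditive_finite) auto
    \<comment> \<open>A cycle longer than \<open>n\<close> is longer than the real number
      \<open>m\<close>, so rounding loses nothing and \<open>\<alpha> * m = b\<close> gives the
      bound.\<close>
    also have "prob (Z n) \<le> exp (- b)"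
      using Z[of m] False m by (simp add: n_def)
    also have "(\<Sum>k\<in>{1..n}. prob (B k)) \<le> (\<Sum>k\<in>{1..n}. real (((k + L) choose L) - 1) * exp (- b))"
    proof (rule sum_mono)
      fix k assume "k \<in> {1..n}"
      then have "real (card (active_paths L k)) \<le> real (((k + L) choose L) - 1)"
        using card_active_paths_le[of k L] by (simp only: of_nat_le_iff) simp
      then show "prob (B k) \<le> real (((k + L) choose L) - 1) * exp (- b)"
        unfolding B_def by (intro order.trans[OF prob_exceeds_le] mult_right_mono) auto
    qed
    also have "\<dots> = real (\<Sum>k\<in>{1..n}. ((k + L) choose L) - 1) * exp (- b)"
      by (simp add: sum_distrib_right)
    also have "\<dots> \<le> real (n ^ (L + 1)) * exp (- b)"
      using sum_choose_le_power[OF n(1) L] by (intro mult_right_mono) (simp_all only: of_nat_le_iff, simp)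
    also have "\<dots> \<le> m ^ (L + 1) * exp (- b)"
      using n power_mono[of "real n" m "L + 1"] by simp
    finally show ?thesis by (simp add: m_def algebra_simps)
  qed
qed

end

theorem proposition1:
  fixes L :: nat and M :: "'a measure" and f :: "nat \<Rightarrow> 'a \<Rightarrow> real"
    and P :: "'w measure" and X :: "nat \<Rightarrow> 'w \<Rightarrow> 'a" and \<alpha> b :: real
  assumes "1 \<le> L"
    and "\<And>i. i \<le> L \<Longrightarrow> is_prob_density M (f i)"
    and "\<And>i. 1 \<le> i \<Longrightarrow> i \<le> L \<Longrightarrow> 0 < kl_div M (f i) (f 0) \<and> kl_div M (f i) (f 0) < \<infinity>"
    and "prob_space P"
    and "prob_space.indep_vars P (\<lambda>_. M) X {1..}"
    and "\<And>k. 1 \<le> k \<Longrightarrow> distributed P M (X k) (\<lambda>x. ennreal (f 0 x))"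
    and "0 < \<alpha>"
    and "\<And>m :: real. 1 \<le> m \<Longrightarrow>
           measure P {w \<in> space P. ereal_of_enat (dcusum_zero_time f L (\<lambda>k. X k w)) > ereal m}
             \<le> exp (- \<alpha> * m)"
    and "0 < b"
  shows "(\<integral>\<^sup>+ w. ennreal_of_enat (dcusum_time f L b (\<lambda>k. X k w)) \<partial>P)
           \<ge> ennreal (exp b / (1 + (b / \<alpha>) ^ (L + 1)))"
proof -
  interpret iid_observations P M f L X
    using assms(1,2,4-6) by (intro iid_observations.intro iid_observations_axioms.intro)
  \<comment> \<open>The bound for the probability of a crossing within one cycle; its reciprocal is
    the claimed lower bound.\<close>
  let ?q = "exp (- b) * (1 + (b / \<alpha>) ^ (L + 1))"
  have "0 < 1 + (b / \<alpha>) ^ (L + 1)"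
    using assms(7,9) by (intro add_pos_nonneg) auto
  then have "0 < ?q" by simp
  then have "ennreal (1 / ?q) \<le> (\<integral>\<^sup>+ w. ennreal_of_enat (dcusum_time f L b (\<lambda>k. X k w)) \<partial>P)"
    using assms(7-9) by (intro expectation_dcusum_time_ge cycle_prob_le) auto
  also have "1 / ?q = exp b / (1 + (b / \<alpha>) ^ (L + 1))"
    by (simp add: exp_minus field_simps)
  finally show ?thesis .
qed

end
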